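(* If $n\leq m$, then $\operatorname{gon}(K_n\square K_m)=(n-1)m$.
   Context: For a positive integer $n$, $K_n$ is the complete graph on $n$ vertices. $G\square H$ is the Cartesian product of graphs: vertices are pairs $(x,y)$ with $x\in V(G)$, $y\in V(H)$; $(x,y_1)\sim(x,y_2)$ when $y_1\sim y_2$ in $H$, and $(x_1,y)\sim(x_2,y)$ when $x_1\sim x_2$ in $G$. Let $G$ be a finite connected loopless graph (multiple edges allowed). A divisor on $G$ is an integer vector $D\in\mathbb{Z}^{V(G)}$ (the coordinate $D(v)$ is thought of as the number of chips on $v$); its degree is $\deg(D)=\sum_v D(v)$; it is effective if $D(v)\ge 0$ for all $v$. Firing a vertex $v$ transforms a divisor by moving one chip from $v$ along each edge incident to $v$ to the other endpoint of that edge. Two divisors are equivalent if one can be obtained from the other by a finite sequence of vertex firings. For an integer $r\ge 0$, a divisor $D$ has rank at least $r$ if for every effective divisor $E$ of degree $r$, the divisor $D-E$ is equivalent to an effective divisor. The gonality $\operatorname{gon}(G)$ is the minimum degree of a divisor on $G$ of rank at least $1$.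
   Formalization: Assumes n ≥ 2 in addition: for n = 1 the formula gives 0, but a divisor of rank at least 1 on K_1□K_m = K_m has degree at least 1, so the claim fails there. *)

theory Defs
  imports "Graph_Theory.Graph_Theory"
begin

text \<open>
  Undirected graphs are represented as in the Graph\_Theory library, by symmetric digraphs: an
  undirected edge between \<open>u\<close> and \<open>v\<close> is a pair of opposite arcs. For multigraphs this requires as
  many arcs from \<open>u\<close> to \<open>v\<close> as from \<open>v\<close> to \<open>u\<close> (\<^locale>\<open>bidirected_digraph\<close>). The out-arcs of a vertex
  then correspond to its incident edges.
\<close>

definition cartesian_product ::
  "('a, 'b) pre_digraph \<Rightarrow> ('c, 'd) pre_digraph \<Rightarrow> ('a \<times> 'c, ('a \<times> 'd) + ('b \<times> 'c)) pre_digraph"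
  (infixr \<open>\<box>\<close> 70) where
  "G \<box> H = \<lparr>
     verts = verts G \<times> verts H,
     arcs = (verts G \<times> arcs H) <+> (arcs G \<times> verts H),
     tail = case_sum (\<lambda>(x, f). (x, tail H f)) (\<lambda>(e, y). (tail G e, y)),
     head = case_sum (\<lambda>(x, f). (x, head H f)) (\<lambda>(e, y). (head G e, y)) \<rparr>"

lemma dominates_cartesian_product_iff:
  "(x\<^sub>1, y\<^sub>1) \<rightarrow>\<^bsub>G \<box> H\<^esub> (x\<^sub>2, y\<^sub>2) \<longleftrightarrow>
     x\<^sub>1 = x\<^sub>2 \<and> x\<^sub>1 \<in> verts G \<and> y\<^sub>1 \<rightarrow>\<^bsub>H\<^esub> y\<^sub>2 \<or> y\<^sub>1 = y\<^sub>2 \<and> y\<^sub>1 \<in> verts H \<and> x\<^sub>1 \<rightarrow>\<^bsub>G\<^esub> x\<^sub>2"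
  unfolding arcs_ends_conv cartesian_product_def by (force simp: image_iff)

text \<open>A divisor is an integer function on the vertex set, extended by zero to the whole type.\<close>

definition divisor :: "('a, 'b) pre_digraph \<Rightarrow> ('a \<Rightarrow> int) \<Rightarrow> bool" where
  "divisor G D \<longleftrightarrow> (\<forall>v. v \<notin> verts G \<longrightarrow> D v = 0)"

definition deg :: "('a, 'b) pre_digraph \<Rightarrow> ('a \<Rightarrow> int) \<Rightarrow> int" where
  "deg G D = (\<Sum>v\<in>verts G. D v)"

definition effective :: "('a, 'b) pre_digraph \<Rightarrow> ('a \<Rightarrow> int) \<Rightarrow> bool" where
  "effective G D \<longleftrightarrow> divisor G D \<and> (\<forall>v\<in>verts G. 0 \<le> D v)"

definition fire :: "('a, 'b) pre_digraph \<Rightarrow> 'a \<Rightarrow> ('a \<Rightarrow> int) \<Rightarrow> ('a \<Rightarrow> int)" where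
  "fire G v D = (\<lambda>w. D w - (if w = v then int (out_degree G v) else 0)
                         + int (card {e \<in> out_arcs G v. head G e = w}))"

definition firing_step :: "('a, 'b) pre_digraph \<Rightarrow> ('a \<Rightarrow> int) \<Rightarrow> ('a \<Rightarrow> int) \<Rightarrow> bool" where
  "firing_step G D D' \<longleftrightarrow> (\<exists>v\<in>verts G. D' = fire G v D)"

text \<open>
  On a finite undirected graph the two disjuncts coincide, since firing every vertex once changes
  no divisor.
\<close>

definition equivalent :: "('a, 'b) pre_digraph \<Rightarrow> ('a \<Rightarrow> int) \<Rightarrow> ('a \<Rightarrow> int) \<Rightarrow> bool" where
  "equivalent G D D' \<longleftrightarrow> (firing_step G)\<^sup>*\<^sup>* D D' \<or> (firing_step G)\<^sup>*\<^sup>* D' D"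

definition rank_at_least :: "('a, 'b) pre_digraph \<Rightarrow> ('a \<Rightarrow> int) \<Rightarrow> nat \<Rightarrow> bool" where
  "rank_at_least G D r \<longleftrightarrow>
     (\<forall>E. effective G E \<and> deg G E = int r \<longrightarrow>
        (\<exists>F. effective G F \<and> equivalent G (\<lambda>v. D v - E v) F))"

text \<open>
  The minimum below exists for every nonempty finite undirected graph: a divisor of rank at least 1 has degree
  at least 1, and the divisor with one chip on each vertex has rank at least 1.
\<close>

definition gonality :: "('a, 'b) pre_digraph \<Rightarrow> int" where
  "gonality G = (LEAST d. \<exists>D. divisor G D \<and> rank_at_least G D 1 \<and> deg G D = d)"

end

theory Submission
  imports Defs
begin

text \<open>
  For the upper bound, put one chip on every vertex outside one copy of \<open>L\<close> and fire all of these
  vertices: the chips move onto that copy.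

  For the lower bound, let \<open>D\<close> have rank at least 1 and degree below \<open>(n - 1) m\<close>, and among the
  effective divisors equivalent to \<open>D\<close> let \<open>E\<close> have least energy \<open>\<langle>E, \<Delta>\<^sup>+ E\<rangle>\<close>. Some column
  (copy of \<open>K\<close>) carries at most \<open>n - 2\<close> chips of \<open>E\<close> and, since \<open>n \<le> m\<close>, some row (copy of \<open>L\<close>) at most
  \<open>m - 2\<close>.
  The row has a chipless vertex \<open>v\<close>, so a nonempty set \<open>U\<close> avoiding \<open>v\<close> can be fired with effective
  result. A line of \<open>k\<close> vertices of which \<open>U\<close> contains some but not all must carry at least \<open>k - 1\<close>
  chips; hence \<open>U\<close> avoids the poor row, and then the poor column as well. So every vertex of \<open>U\<close> has at
  least two neighbours outside \<open>U\<close>, and because the average number of chips per vertex is below 1,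
  firing \<open>U\<close> lowers the energy.
\<close>

section \<open>The Laplacian of a product of complete graphs\<close>

text \<open>Both sums include the vertex itself, which turns its degree \<open>n + m - 2\<close>
  into the coefficient \<open>n + m\<close>. With \<open>f\<close> counting firings,
  \<open>D - rook_laplacian A B f\<close> is the resulting divisor; the value 0 off the grid makes
  this an identity on the whole type.\<close>

definition rook_laplacian :: "'a set \<Rightarrow> 'c set \<Rightarrow> ('a \<times> 'c \<Rightarrow> int) \<Rightarrow> 'a \<times> 'c \<Rightarrow> int" where
  "rook_laplacian A B f = (\<lambda>(x, y). if x \<in> A \<and> y \<in> B
     then (int (card A) + int (card B)) * f (x, y) - (\<Sum>x'\<in>A. f (x', y)) - (\<Sum>y'\<in>B. f (x, y'))
     else 0)"

lemma rook_laplacian_add: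
  "rook_laplacian A B (\<lambda>v. f v + g v) v = rook_laplacian A B f v + rook_laplacian A B g v"
  by (cases v) (simp add: rook_laplacian_def sum.distrib algebra_simps)

lemma rook_laplacian_diff:
  "rook_laplacian A B (\<lambda>v. f v - g v) v = rook_laplacian A B f v - rook_laplacian A B g v"
  by (cases v) (simp add: rook_laplacian_def sum_subtractf algebra_simps)

lemma rook_laplacian_uminus:
  "rook_laplacian A B (\<lambda>v. - f v) v = - rook_laplacian A B f v"
  by (cases v) (simp add: rook_laplacian_def sum_negf algebra_simps)

text \<open>Edges inside a row cancel, so what remains is the Laplacian of the complete graph on the
  rows, applied to the row sums.\<close>

lemma sum_row_rook_laplacian:
  assumes "x \<in> A"
  shows "(\<Sum>y\<in>B. rook_laplacian A B f (x, y))
    = int (card A) * (\<Sum>y\<in>B. f (x, y)) - (\<Sum>x\<in>A. \<Sum>y\<in>B. f (x, y))"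
  using assms
  by (simp add: rook_laplacian_def sum_subtractf sum_distrib_left[symmetric] sum.swap[of _ B A])
    (simp add: algebra_simps)

lemma sum_column_rook_laplacian:
  assumes "y \<in> B"
  shows "(\<Sum>x\<in>A. rook_laplacian A B f (x, y))
    = int (card B) * (\<Sum>x\<in>A. f (x, y)) - (\<Sum>x\<in>A. \<Sum>y\<in>B. f (x, y))"
  using assms
  by (simp add: rook_laplacian_def sum_subtractf sum_distrib_left[symmetric])
    (simp add: algebra_simps)

lemma sum_rook_laplacian: "(\<Sum>x\<in>A. \<Sum>y\<in>B. rook_laplacian A B f (x, y)) = 0"
  by (simp add: sum_row_rook_laplacian sum_subtractf sum_distrib_left[symmetric])

section \<open>The energy form\<close>

text \<open>
  With \<open>n = card A\<close> and \<open>m = card B\<close>, up to the factor \<open>nm(n + m)\<close> and a term depending only on the degrees, this is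
  \<open>\<langle>D, \<Delta>\<^sup>+ E\<rangle>\<close>: the pseudoinverse of \<open>\<Delta> = (n + m) I - R - C\<close>, with \<open>R\<close> and \<open>C\<close> the row and column sum
  operators, is \<open>(I + R/n + C/m) / (n + m)\<close> modulo the all-ones matrix.
\<close>

definition rook_form :: "'a set \<Rightarrow> 'c set \<Rightarrow> ('a \<times> 'c \<Rightarrow> int) \<Rightarrow> ('a \<times> 'c \<Rightarrow> int) \<Rightarrow> int" where
  "rook_form A B D E =
     int (card A) * int (card B) * (\<Sum>x\<in>A. \<Sum>y\<in>B. D (x, y) * E (x, y))
     + int (card B) * (\<Sum>x\<in>A. (\<Sum>y\<in>B. D (x, y)) * (\<Sum>y\<in>B. E (x, y)))
     + int (card A) * (\<Sum>y\<in>B. (\<Sum>x\<in>A. D (x, y)) * (\<Sum>x\<in>A. E (x, y)))"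

lemma rook_form_commute: "rook_form A B D E = rook_form A B E D"
  by (simp add: rook_form_def mult.commute)

lemma rook_form_diff_right:
  "rook_form A B D (\<lambda>v. E v - F v) = rook_form A B D E - rook_form A B D F"
  by (simp add: rook_form_def sum_subtractf right_diff_distrib)

lemma rook_form_nonneg: "0 \<le> rook_form A B D D"
  by (simp add: rook_form_def sum_nonneg)

text \<open>The form inverts the Laplacian: the mixed sums \<open>R\<close> and \<open>C\<close>
  arising in its three summands cancel under the weights \<open>n * m\<close>, \<open>m\<close> and
  \<open>n\<close>. What is left is the pairing of \<open>D\<close> with \<open>f\<close> minus its
  mean.\<close>

lemma rook_form_laplacian:
  "rook_form A B D (rook_laplacian A B f) =
     (int (card A) + int (card B)) *
     (int (card A) * int (card B) * (\<Sum>x\<in>A. \<Sum>y\<in>B. D (x, y) * f (x, y))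
      - (\<Sum>x\<in>A. \<Sum>y\<in>B. f (x, y)) * (\<Sum>x\<in>A. \<Sum>y\<in>B. D (x, y)))"
proof -
  define n m where "n = int (card A)" and "m = int (card B)"
  define T d P where "T = (\<Sum>x\<in>A. \<Sum>y\<in>B. f (x, y))" and "d = (\<Sum>x\<in>A. \<Sum>y\<in>B. D (x, y))"
    and "P = (\<Sum>x\<in>A. \<Sum>y\<in>B. D (x, y) * f (x, y))"
  define R where "R = (\<Sum>x\<in>A. (\<Sum>y\<in>B. D (x, y)) * (\<Sum>y\<in>B. f (x, y)))"
  define C where "C = (\<Sum>y\<in>B. (\<Sum>x\<in>A. D (x, y)) * (\<Sum>x\<in>A. f (x, y)))"
  have "(\<Sum>x\<in>A. \<Sum>y\<in>B. D (x, y) * rook_laplacian A B f (x, y))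
    = (\<Sum>x\<in>A. \<Sum>y\<in>B. (n + m) * (D (x, y) * f (x, y)) - D (x, y) * (\<Sum>x'\<in>A. f (x', y))
        - D (x, y) * (\<Sum>y'\<in>B. f (x, y')))"
    by (intro sum.cong refl) (simp add: rook_laplacian_def n_def m_def algebra_simps)
  also have "\<dots> = (n + m) * P - (\<Sum>x\<in>A. \<Sum>y\<in>B. D (x, y) * (\<Sum>x'\<in>A. f (x', y)))
      - (\<Sum>x\<in>A. \<Sum>y\<in>B. D (x, y) * (\<Sum>y'\<in>B. f (x, y')))"
    by (simp only: P_def sum_subtractf sum_distrib_left)
  also have "(\<Sum>x\<in>A. \<Sum>y\<in>B. D (x, y) * (\<Sum>x'\<in>A. f (x', y))) = C"
    unfolding C_def by (subst sum.swap) (simp add: sum_distrib_right)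
  also have "(\<Sum>x\<in>A. \<Sum>y\<in>B. D (x, y) * (\<Sum>y'\<in>B. f (x, y'))) = R"
    unfolding R_def by (simp add: sum_distrib_right)
  finally have 1: "(\<Sum>x\<in>A. \<Sum>y\<in>B. D (x, y) * rook_laplacian A B f (x, y)) = (n + m) * P - C - R" .
  have "(\<Sum>x\<in>A. (\<Sum>y\<in>B. D (x, y)) * (\<Sum>y\<in>B. rook_laplacian A B f (x, y)))
    = (\<Sum>x\<in>A. n * ((\<Sum>y\<in>B. D (x, y)) * (\<Sum>y\<in>B. f (x, y))) - (\<Sum>y\<in>B. D (x, y)) * T)"
    by (intro sum.cong refl) (simp add: sum_row_rook_laplacian n_def T_def right_diff_distrib)
  also have "\<dots> = n * R - d * T"
    by (simp only: sum_subtractf R_def d_def sum_distrib_left sum_distrib_right)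
  finally have 2: "(\<Sum>x\<in>A. (\<Sum>y\<in>B. D (x, y)) * (\<Sum>y\<in>B. rook_laplacian A B f (x, y))) = n * R - d * T" .
  have "(\<Sum>y\<in>B. (\<Sum>x\<in>A. D (x, y)) * (\<Sum>x\<in>A. rook_laplacian A B f (x, y)))
    = (\<Sum>y\<in>B. m * ((\<Sum>x\<in>A. D (x, y)) * (\<Sum>x\<in>A. f (x, y))) - (\<Sum>x\<in>A. D (x, y)) * T)"
    by (intro sum.cong refl) (simp add: sum_column_rook_laplacian m_def T_def right_diff_distrib)
  also have "\<dots> = m * C - (\<Sum>y\<in>B. \<Sum>x\<in>A. D (x, y)) * T"
    by (simp only: sum_subtractf C_def sum_distrib_left sum_distrib_right)
  also have "(\<Sum>y\<in>B. \<Sum>x\<in>A. D (x, y)) = d" unfolding d_def by (rule sum.swap)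
  finally have 3: "(\<Sum>y\<in>B. (\<Sum>x\<in>A. D (x, y)) * (\<Sum>x\<in>A. rook_laplacian A B f (x, y))) = m * C - d * T" .
  show ?thesis
    unfolding rook_form_def 1 2 3 unfolding n_def[symmetric] m_def[symmetric] T_def[symmetric]
      d_def[symmetric] P_def[symmetric]
    by (simp add: algebra_simps)
qed

text \<open>Measures the energy change caused by the script \<open>f\<close>. The quadratic term
  needs no mean correction, as a Laplacian has degree 0. For the indicator of a nonempty
  \<open>U\<close>, the energy drops if \<open>2 * D - rook_laplacian A B f\<close> is at least 2 on
  \<open>U\<close> and \<open>D\<close> averages below 1.\<close>

lemma rook_form_diff_laplacian:
  "rook_form A B (\<lambda>v. D v - rook_laplacian A B f v) (\<lambda>v. D v - rook_laplacian A B f v) =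
     rook_form A B D D
     - (int (card A) + int (card B)) *
       (int (card A) * int (card B) *
          (\<Sum>x\<in>A. \<Sum>y\<in>B. (2 * D (x, y) - rook_laplacian A B f (x, y)) * f (x, y))
        - 2 * (\<Sum>x\<in>A. \<Sum>y\<in>B. f (x, y)) * (\<Sum>x\<in>A. \<Sum>y\<in>B. D (x, y)))"
proof -
  let ?L = "rook_laplacian A B f"
  have 1: "rook_form A B (\<lambda>v. D v - ?L v) (\<lambda>v. D v - ?L v)
    = rook_form A B D D - 2 * rook_form A B D ?L + rook_form A B ?L ?L"
    by (simp add: rook_form_diff_right rook_form_commute[of _ _ "\<lambda>v. D v - ?L v"]
        rook_form_commute[of A B ?L D])
  have 2: "(\<Sum>x\<in>A. \<Sum>y\<in>B. (2 * D (x, y) - ?L (x, y)) * f (x, y))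
    = 2 * (\<Sum>x\<in>A. \<Sum>y\<in>B. D (x, y) * f (x, y)) - (\<Sum>x\<in>A. \<Sum>y\<in>B. ?L (x, y) * f (x, y))"
    by (simp add: left_diff_distrib sum_subtractf sum_distrib_left mult.assoc)
  show ?thesis
    unfolding 1 2 rook_form_laplacian sum_rook_laplacian by (simp add: algebra_simps)
qed

section \<open>Firing sets and the maximum principle\<close>

text \<open>Edges within \<open>U\<close> carry a chip each way and edges outside \<open>U\<close>
  carry none, so only edges across the boundary count.\<close>

lemma rook_laplacian_indicator:
  assumes "finite A" "finite B" "x \<in> A" "y \<in> B"
  shows "rook_laplacian A B (\<lambda>v. of_bool (v \<in> U)) (x, y) =
    (if (x, y) \<in> U then int (card {x' \<in> A. (x', y) \<notin> U}) + int (card {y' \<in> B. (x, y') \<notin> U})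
     else - int (card {x' \<in> A. (x', y) \<in> U}) - int (card {y' \<in> B. (x, y') \<in> U}))"
proof -
  have "card A = card ({x' \<in> A. (x', y) \<in> U} \<union> {x' \<in> A. (x', y) \<notin> U})"
    "card B = card ({y' \<in> B. (x, y') \<in> U} \<union> {y' \<in> B. (x, y') \<notin> U})"
    by (rule arg_cong[where f = card], blast)+
  then have "card A = card {x' \<in> A. (x', y) \<in> U} + card {x' \<in> A. (x', y) \<notin> U}"
    "card B = card {y' \<in> B. (x, y') \<in> U} + card {y' \<in> B. (x, y') \<notin> U}"
    using assms(1,2) by (simp_all add: card_Un_disjoint disjoint_iff)
  then show ?thesis
    using assms by (simp add: rook_laplacian_def of_bool_def sum.If_cases Int_def)
qed

text \<open>If both \<open>S - U\<close> (size \<open>c\<close>) and \<open>S \<inter> U\<close>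
  (size \<open>k\<close>) were nonempty, each of the \<open>k\<close> fired vertices would hold
  \<open>c\<close> chips, and \<open>k * c \<ge> k + c - 1 = card S - 1\<close> because
  \<open>(c - 1) * (k - 1) \<ge> 0\<close>.\<close>

lemma fireable_avoids_poor_line:
  fixes D :: "'a \<Rightarrow> int"
  assumes "finite S"
    and nonneg: "\<And>u. u \<in> S \<Longrightarrow> 0 \<le> D u"
    and fireable: "\<And>u. u \<in> S \<inter> U \<Longrightarrow> int (card (S - U)) \<le> D u"
    and poor: "sum D S \<le> int (card S) - 2"
    and "S - U \<noteq> {}"
  shows "S \<inter> U = {}"
proof (rule ccontr)
  assume "S \<inter> U \<noteq> {}"
  define c k where "c = int (card (S - U))" and "k = int (card (S \<inter> U))"
  have ck: "1 \<le> c" "1 \<le> k"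
    using \<open>finite S\<close> \<open>S - U \<noteq> {}\<close> \<open>S \<inter> U \<noteq> {}\<close>
    by (simp_all add: c_def k_def Suc_leI card_gt_0_iff flip: of_nat_Suc)
  have "int (card S) = c + k"
    using card_Un_disjoint[of "S - U" "S \<inter> U"] \<open>finite S\<close>
    by (simp add: c_def k_def Un_Diff_Int disjoint_iff)
  moreover have "k * c \<le> sum D (S \<inter> U)"
    using sum_bounded_below[of "S \<inter> U" c D] fireable by (simp add: c_def k_def)
  moreover have "sum D (S \<inter> U) \<le> sum D S"
    using \<open>finite S\<close> nonneg by (intro sum_mono2) auto
  moreover have "0 \<le> (c - 1) * (k - 1)" using ck by simp
  ultimately show False using poor by (simp add: algebra_simps)
qed

text \<open>On the grid the Laplacian is a sum of differences \<open>f v - f w\<close> over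
  neighbours \<open>w\<close>, none of them negative at a maximum; off the grid it is 0.\<close>

lemma rook_laplacian_at_maximum:
  assumes "\<And>w. w \<in> A \<times> B \<Longrightarrow> f w \<le> f v"
  shows "0 \<le> rook_laplacian A B f v"
proof (cases v)
  case (Pair x y)
  have "(\<Sum>x'\<in>A. f (x', y)) \<le> int (card A) * f v" if "y \<in> B"
    using assms that by (intro sum_bounded_above) auto
  moreover have "(\<Sum>y'\<in>B. f (x, y')) \<le> int (card B) * f v" if "x \<in> A"
    using assms that by (intro sum_bounded_above) auto
  ultimately show ?thesis
    using Pair by (auto simp: rook_laplacian_def algebra_simps)
qed

section \<open>The lower bound on the grid\<close>

text \<open>A form of the lower bound without arcs: the integer scripts \<open>f\<close> stand for
  equivalence, and \<open>reach\<close> stands for rank at least 1.\<close>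

lemma rook_degree_lower_bound:
  assumes fin: "finite A" "finite B"
    and le: "card A \<le> card B"
    and reach: "\<And>v. v \<in> A \<times> B \<Longrightarrow>
      \<exists>f. (\<forall>w\<in>A \<times> B. 0 \<le> D w - rook_laplacian A B f w) \<and> 1 \<le> D v - rook_laplacian A B f v"
  shows "(int (card A) - 1) * int (card B) \<le> (\<Sum>x\<in>A. \<Sum>y\<in>B. D (x, y))"
proof (rule ccontr)
  define n m d where "n = int (card A)" and "m = int (card B)"
    and "d = (\<Sum>x\<in>A. \<Sum>y\<in>B. D (x, y))"
  let ?L = "rook_laplacian A B"
  assume "\<not> ?thesis"
  then have small: "d < (n - 1) * m" by (simp add: n_def m_def d_def)
  have "A \<noteq> {}" "B \<noteq> {}"
    using small by (auto simp: n_def m_def d_def)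
  then have pos: "1 \<le> n" "1 \<le> m"
    using fin by (simp_all add: n_def m_def Suc_leI card_gt_0_iff flip: of_nat_Suc)
  define \<C> where "\<C> = {E. (\<exists>f. E = (\<lambda>w. D w - ?L f w)) \<and> (\<forall>w\<in>A \<times> B. 0 \<le> E w)}"
  have "\<exists>E. E \<in> \<C>"
    using \<open>A \<noteq> {}\<close> \<open>B \<noteq> {}\<close> reach unfolding \<C>_def by blast
  \<comment> \<open>Energies are integers, nonnegative by \<open>rook_form_nonneg\<close>, so a
    minimum exists and \<open>nat\<close> loses nothing.\<close>
  then obtain E where "E \<in> \<C>"
    and minimal: "\<And>F. F \<in> \<C> \<Longrightarrow> nat (rook_form A B E E) \<le> nat (rook_form A B F F)"
    using ex_has_least_nat[where P = "\<lambda>E. E \<in> \<C>" and m = "\<lambda>E. nat (rook_form A B E E)"] by blast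
  then obtain f\<^sub>0 where E: "E = (\<lambda>w. D w - ?L f\<^sub>0 w)"
    and E_nonneg: "\<And>x y. x \<in> A \<Longrightarrow> y \<in> B \<Longrightarrow> 0 \<le> E (x, y)"
    unfolding \<C>_def by auto
  have deg_E: "(\<Sum>x\<in>A. \<Sum>y\<in>B. E (x, y)) = d"
    by (simp add: E sum_subtractf sum_rook_laplacian d_def)
  \<comment> \<open>Otherwise \<open>d \<ge> n * (m - 1) = n * m - n \<ge> n * m - m\<close>; this
    is where \<open>n \<le> m\<close> enters.\<close>
  have "\<exists>x\<in>A. (\<Sum>y\<in>B. E (x, y)) \<le> m - 2"
  proof (rule ccontr)
    assume "\<not> ?thesis"
    then have "n * (m - 1) \<le> d"
      using sum_bounded_below[of A "m - 1" "\<lambda>x. \<Sum>y\<in>B. E (x, y)"] by (force simp: n_def deg_E)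
    then show False
      using small le by (simp add: n_def m_def algebra_simps)
  qed
  then obtain x\<^sub>0 where x\<^sub>0: "x\<^sub>0 \<in> A" "(\<Sum>y\<in>B. E (x\<^sub>0, y)) \<le> m - 2" by blast
  have "\<exists>y\<in>B. (\<Sum>x\<in>A. E (x, y)) \<le> n - 2"
  proof (rule ccontr)
    assume "\<not> ?thesis"
    then have "m * (n - 1) \<le> (\<Sum>y\<in>B. \<Sum>x\<in>A. E (x, y))"
      using sum_bounded_below[of B "n - 1" "\<lambda>y. \<Sum>x\<in>A. E (x, y)"] by (force simp: m_def)
    then show False
      using small by (simp add: sum.swap[of _ A B] deg_E algebra_simps)
  qed
  then obtain y\<^sub>0 where y\<^sub>0: "y\<^sub>0 \<in> B" "(\<Sum>x\<in>A. E (x, y\<^sub>0)) \<le> n - 2" by blast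
  have "\<exists>y\<in>B. E (x\<^sub>0, y) = 0"
  proof (rule ccontr)
    assume "\<not> ?thesis"
    then have "1 \<le> E (x\<^sub>0, y)" if "y \<in> B" for y
      using that E_nonneg[OF x\<^sub>0(1) that] by force
    then show False
      using sum_bounded_below[of B 1 "\<lambda>y. E (x\<^sub>0, y)"] x\<^sub>0(2) by (simp add: m_def)
  qed
  then obtain y\<^sub>1 where y\<^sub>1: "y\<^sub>1 \<in> B" "E (x\<^sub>0, y\<^sub>1) = 0" by blast
  obtain f\<^sub>1 where f\<^sub>1: "\<forall>w\<in>A \<times> B. 0 \<le> D w - ?L f\<^sub>1 w" "1 \<le> D (x\<^sub>0, y\<^sub>1) - ?L f\<^sub>1 (x\<^sub>0, y\<^sub>1)"
    using reach[of "(x\<^sub>0, y\<^sub>1)"] x\<^sub>0 y\<^sub>1 by auto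
  \<comment> \<open>This script carries \<open>E\<close> to a configuration with a chip on
    \<open>(x\<^sub>0, y\<^sub>1)\<close>. Only its top level set \<open>U\<close> is going to be
    fired.\<close>
  define f where "f = (\<lambda>w. f\<^sub>1 w - f\<^sub>0 w)"
  have E_f: "E w - ?L f w = D w - ?L f\<^sub>1 w" for w
    by (simp add: E f_def rook_laplacian_diff)
  define M where "M = Max (f ` (A \<times> B))"
  have fM: "f w \<le> M" if "w \<in> A \<times> B" for w
    using that fin by (simp add: M_def)
  define U where "U = {w \<in> A \<times> B. f w = M}"
  let ?u = "\<lambda>w. of_bool (w \<in> U) :: int"
  have U_sub: "U \<subseteq> A \<times> B" by (auto simp: U_def)
  have "M \<in> f ` (A \<times> B)"
    unfolding M_def using fin \<open>A \<noteq> {}\<close> \<open>B \<noteq> {}\<close> by (intro Max_in) auto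
  then have "U \<noteq> {}" by (auto simp: U_def)
  \<comment> \<open>Off \<open>U\<close> the integer \<open>f\<close> is at most
    \<open>M - 1\<close>, so \<open>f - ?u\<close> is maximal at every point of
    \<open>U\<close>.\<close>
  have le_f: "?L ?u w \<le> ?L f w" if "w \<in> U" for w
  proof -
    have "0 \<le> ?L (\<lambda>w. f w - ?u w) w"
    proof (rule rook_laplacian_at_maximum)
      fix z assume "z \<in> A \<times> B"
      then have "f z \<le> M" "z \<notin> U \<Longrightarrow> f z \<noteq> M"
        using fM by (auto simp: U_def)
      then show "f z - ?u z \<le> f w - ?u w"
        using that by (cases "z \<in> U") (auto simp: U_def)
    qed
    then show ?thesis by (simp add: rook_laplacian_diff)
  qed
  have fireable: "?L ?u w \<le> E w" if "w \<in> U" for w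
    using le_f[OF that] f\<^sub>1(1) U_sub that E_f[of w] by fastforce
  have L_u: "?L ?u (x, y) = int (card {x' \<in> A. (x', y) \<notin> U}) + int (card {y' \<in> B. (x, y') \<notin> U})"
    if "(x, y) \<in> U" for x y
    using that U_sub fin by (subst rook_laplacian_indicator) auto
  \<comment> \<open>Gaining a chip at a chipless vertex forces \<open>?L f \<le> -1\<close> there,
    but on \<open>U\<close> one has \<open>?L f \<ge> ?L ?u \<ge> 0\<close>.\<close>
  have "(x\<^sub>0, y\<^sub>1) \<notin> U"
    using le_f[of "(x\<^sub>0, y\<^sub>1)"] L_u[of x\<^sub>0 y\<^sub>1] f\<^sub>1(2) E_f[of "(x\<^sub>0, y\<^sub>1)"] y\<^sub>1 by force
  have row: "B \<inter> {y. (x\<^sub>0, y) \<in> U} = {}"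
  proof (rule fireable_avoids_poor_line[where D = "\<lambda>y. E (x\<^sub>0, y)"])
    fix y assume "y \<in> B \<inter> {y. (x\<^sub>0, y) \<in> U}"
    moreover have "B - {y. (x\<^sub>0, y) \<in> U} = {y \<in> B. (x\<^sub>0, y) \<notin> U}" by auto
    ultimately show "int (card (B - {y. (x\<^sub>0, y) \<in> U})) \<le> E (x\<^sub>0, y)"
      using fireable[of "(x\<^sub>0, y)"] L_u[of x\<^sub>0 y] by simp
  qed (use fin x\<^sub>0 y\<^sub>1 E_nonneg \<open>(x\<^sub>0, y\<^sub>1) \<notin> U\<close> in \<open>auto simp: m_def\<close>)
  \<comment> \<open>The poor column is not contained in \<open>U\<close>: it crosses the poor row at
    \<open>(x\<^sub>0, y\<^sub>0)\<close>, which \<open>row\<close> excludes.\<close>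
  have column: "A \<inter> {x. (x, y\<^sub>0) \<in> U} = {}"
  proof (rule fireable_avoids_poor_line[where D = "\<lambda>x. E (x, y\<^sub>0)"])
    fix x assume "x \<in> A \<inter> {x. (x, y\<^sub>0) \<in> U}"
    moreover have "A - {x. (x, y\<^sub>0) \<in> U} = {x \<in> A. (x, y\<^sub>0) \<notin> U}" by auto
    ultimately show "int (card (A - {x. (x, y\<^sub>0) \<in> U})) \<le> E (x, y\<^sub>0)"
      using fireable[of "(x, y\<^sub>0)"] L_u[of x y\<^sub>0] by simp
  qed (use fin x\<^sub>0 y\<^sub>0 row E_nonneg in \<open>auto simp: n_def\<close>)
  \<comment> \<open>The neighbours \<open>(x\<^sub>0, y)\<close> and \<open>(x, y\<^sub>0)\<close>
    lie on the two poor lines, hence outside \<open>U\<close>.\<close>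
  have two: "2 \<le> ?L ?u w" if "w \<in> U" for w
  proof (cases w)
    case (Pair x y)
    then have "x\<^sub>0 \<in> {x' \<in> A. (x', y) \<notin> U}" "y\<^sub>0 \<in> {y' \<in> B. (x, y') \<notin> U}"
      using that U_sub x\<^sub>0 y\<^sub>0 row column by auto
    then have "card {x' \<in> A. (x', y) \<notin> U} \<noteq> 0" "card {y' \<in> B. (x, y') \<notin> U} \<noteq> 0"
      using fin by auto
    then show ?thesis
      using L_u that Pair by simp
  qed
  define F where "F = (\<lambda>w. E w - ?L ?u w)"
  have "F = (\<lambda>w. D w - ?L (\<lambda>w. f\<^sub>0 w + ?u w) w)"
    unfolding F_def E rook_laplacian_add by auto
  moreover have "0 \<le> F w" if w: "w \<in> A \<times> B" for w
  proof (cases "w \<in> U")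
    case True
    then show ?thesis using fireable by (simp add: F_def)
  next
    case False
    \<comment> \<open>Off \<open>U\<close> the function \<open>- ?u\<close> attains its maximum 0,
      so firing \<open>U\<close> removes no chips there.\<close>
    have "0 \<le> ?L (\<lambda>w. - ?u w) w"
      by (rule rook_laplacian_at_maximum) (use False in auto)
    moreover have "0 \<le> E w" using w E_nonneg by auto
    ultimately show ?thesis by (simp add: F_def rook_laplacian_uminus)
  qed
  ultimately have "F \<in> \<C>" unfolding \<C>_def by blast
  define T where "T = (\<Sum>x\<in>A. \<Sum>y\<in>B. ?u (x, y))"
  define P where "P = (\<Sum>x\<in>A. \<Sum>y\<in>B. (2 * E (x, y) - ?L ?u (x, y)) * ?u (x, y))"
  have "T = (\<Sum>w\<in>A \<times> B. ?u w)"
    by (simp add: T_def sum.cartesian_product)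
  also have "\<dots> = int (card U)"
    using fin U_sub by (simp add: of_bool_def sum.If_cases Int_absorb1 flip: Int_def)
  finally have "0 < T"
    using fin U_sub \<open>U \<noteq> {}\<close> by (simp add: card_gt_0_iff finite_subset)
  \<comment> \<open>On \<open>U\<close>, \<open>fireable\<close> and \<open>two\<close> give
    \<open>2 * E - ?L ?u \<ge> ?L ?u \<ge> 2\<close>; off \<open>U\<close> both summands
    vanish.\<close>
  have "2 * T \<le> P"
    unfolding T_def P_def sum_distrib_left
  proof (intro sum_mono)
    fix x y
    show "2 * ?u (x, y) \<le> (2 * E (x, y) - ?L ?u (x, y)) * ?u (x, y)"
      using fireable[of "(x, y)"] two[of "(x, y)"] by auto
  qed
  have "d < n * m" using small pos by (simp add: algebra_simps)
  then have "2 * T * d < n * m * (2 * T)"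
    using \<open>0 < T\<close> by simp
  also have "\<dots> \<le> n * m * P"
    using \<open>2 * T \<le> P\<close> pos by (intro mult_left_mono) auto
  finally have "0 < (n + m) * (n * m * P - 2 * T * d)"
    using pos by simp
  then have "rook_form A B F F < rook_form A B E E"
    unfolding F_def rook_form_diff_laplacian deg_E
    by (simp add: n_def m_def P_def T_def)
  then show False
    using minimal[OF \<open>F \<in> \<C>\<close>] rook_form_nonneg[of A B F] by simp
qed

section \<open>Chip firing on the product digraph\<close>

text \<open>There are no parallel arcs, so \<open>head\<close> maps the out-arcs of \<open>x\<close>
  bijectively onto the other vertices.\<close>

lemma complete_digraph_out_arcs:
  assumes "complete_digraph n G" "x \<in> verts G"
  shows "out_degree G x = n - 1"
    and "card {e \<in> out_arcs G x. head G e = w} = of_bool (w \<in> verts G \<and> w \<noteq> x)"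
proof -
  interpret graph G using assms(1) by (simp add: complete_digraph_def)
  have ends: "arcs_ends G = {(u, v). (u, v) \<in> verts G \<times> verts G \<and> u \<noteq> v}" and n: "card (verts G) = n"
    using assms(1) by (simp_all add: complete_digraph_def)
  have inj: "inj_on (head G) (out_arcs G x)"
    by (rule inj_onI) (auto intro: no_multi_arcs simp: arc_to_ends_def)
  have img: "head G ` out_arcs G x = verts G - {x}"
  proof (rule set_eqI)
    fix w
    have "w \<in> head G ` out_arcs G x \<longleftrightarrow> (x, w) \<in> arcs_ends G"
      by (force simp: arcs_ends_conv image_iff)
    then show "w \<in> head G ` out_arcs G x \<longleftrightarrow> w \<in> verts G - {x}"
      using ends assms(2) by auto
  qed
  show "out_degree G x = n - 1"
    using card_image[OF inj] assms(2) by (simp add: img n out_degree_def)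
  have "head G ` {e \<in> out_arcs G x. head G e = w} = head G ` out_arcs G x \<inter> {w}"
    by (auto simp del: in_out_arcs_conv)
  also have "\<dots> = (if w \<in> verts G \<and> w \<noteq> x then {w} else {})"
    by (auto simp: img)
  finally have "card (head G ` {e \<in> out_arcs G x. head G e = w}) = of_bool (w \<in> verts G \<and> w \<noteq> x)"
    by simp
  then show "card {e \<in> out_arcs G x. head G e = w} = of_bool (w \<in> verts G \<and> w \<noteq> x)"
    by (subst (asm) card_image[OF inj_on_subset[OF inj]]) auto
qed

lemma verts_cartesian_product [simp]: "verts (G \<box> H) = verts G \<times> verts H"
  by (simp add: cartesian_product_def)

lemma out_arcs_cartesian_product:
  assumes "x \<in> verts G" "y \<in> verts H"
  shows "out_arcs (G \<box> H) (x, y) = Pair x ` out_arcs H y <+> (\<lambda>e. (e, y)) ` out_arcs G x"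
  using assms by (auto simp: out_arcs_def cartesian_product_def)

lemma fire_complete_product:
  fixes K :: "('a, 'b) pre_digraph" and L :: "('c, 'd) pre_digraph"
  assumes K: "complete_digraph n K" and L: "complete_digraph m L" and v: "v \<in> verts (K \<box> L)"
  shows "fire (K \<box> L) v D =
    (\<lambda>w. D w - rook_laplacian (verts K) (verts L) (\<lambda>u. of_bool (u = v)) w)"
proof
  fix w :: "'a \<times> 'c"
  obtain a b x y where [simp]: "v = (a, b)" "w = (x, y)" by (cases v, cases w) auto
  have ab: "a \<in> verts K" "b \<in> verts L" using v by auto
  interpret K: graph K using K by (simp add: complete_digraph_def)
  interpret L: graph L using L by (simp add: complete_digraph_def)
  have cards: "card (verts K) = n" "card (verts L) = m"
    using K L by (simp_all add: complete_digraph_def)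
  \<comment> \<open>This turns the truncated differences \<open>n - 1\<close> and
    \<open>m - 1\<close> into integer ones.\<close>
  have "n \<noteq> 0" "m \<noteq> 0"
    using ab K.finite_verts L.finite_verts unfolding cards[symmetric] by (metis card_0_eq empty_iff)+
  have "out_degree (K \<box> L) v = card (out_arcs L b) + card (out_arcs K a)"
    using ab by (simp add: out_degree_def out_arcs_cartesian_product card_Plus card_image inj_on_def
        K.finite_out_arcs L.finite_out_arcs)
  then have deg: "int (out_degree (K \<box> L) v) = int n + int m - 2"
    using complete_digraph_out_arcs(1)[OF K ab(1)] complete_digraph_out_arcs(1)[OF L ab(2)]
      \<open>n \<noteq> 0\<close> \<open>m \<noteq> 0\<close> by (simp add: out_degree_def of_nat_diff)
  have "{e \<in> out_arcs (K \<box> L) v. head (K \<box> L) e = w} =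
      (if x = a then Pair a ` {e \<in> out_arcs L b. head L e = y} else {}) <+>
      (if y = b then (\<lambda>e. (e, b)) ` {e \<in> out_arcs K a. head K e = x} else {})"
    using ab by (auto simp: out_arcs_cartesian_product cartesian_product_def)
  then have card: "card {e \<in> out_arcs (K \<box> L) v. head (K \<box> L) e = w} =
      of_bool (x = a \<and> y \<in> verts L \<and> y \<noteq> b) + of_bool (y = b \<and> x \<in> verts K \<and> x \<noteq> a)"
    using ab complete_digraph_out_arcs(2)[OF K, of a x] complete_digraph_out_arcs(2)[OF L, of b y]
    by (cases "x = a"; cases "y = b")
      (simp_all add: card_Plus card_image inj_on_def K.finite_out_arcs L.finite_out_arcs
        del: in_out_arcs_conv)
  have sums: "(\<Sum>x'\<in>verts K. of_bool ((x', y) = v)) = (of_bool (y = b) :: int)"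
    "(\<Sum>y'\<in>verts L. of_bool ((x, y') = v)) = (of_bool (x = a) :: int)"
    using ab by (simp_all add: of_bool_conj flip: sum_distrib_left sum_distrib_right)
  have "rook_laplacian (verts K) (verts L) (\<lambda>u. of_bool (u = v)) w =
      (if x \<in> verts K \<and> y \<in> verts L
       then (int n + int m) * of_bool (x = a \<and> y = b) - of_bool (y = b) - of_bool (x = a) else 0)"
    unfolding rook_laplacian_def \<open>w = (x, y)\<close> prod.case sums cards by simp
  then show "fire (K \<box> L) v D w =
      D w - rook_laplacian (verts K) (verts L) (\<lambda>u. of_bool (u = v)) w"
    unfolding fire_def deg card using ab by (cases "x = a"; cases "y = b") simp_all
qed

lemma firing_steps_complete_product:
  assumes "complete_digraph n K" "complete_digraph m L" "(firing_step (K \<box> L))\<^sup>*\<^sup>* D F"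
  shows "\<exists>f. F = (\<lambda>w. D w - rook_laplacian (verts K) (verts L) f w)"
  using assms(3)
proof (induction rule: rtranclp_induct)
  case base
  show ?case by (rule exI[of _ "\<lambda>_. 0"]) (auto simp: rook_laplacian_def)
next
  case (step F F')
  then obtain f v where "F = (\<lambda>w. D w - rook_laplacian (verts K) (verts L) f w)"
    "v \<in> verts (K \<box> L)" "F' = fire (K \<box> L) v F"
    by (auto simp: firing_step_def)
  then have "F' = (\<lambda>w. D w - rook_laplacian (verts K) (verts L) (\<lambda>u. f u + of_bool (u = v)) w)"
    by (simp add: fire_complete_product[OF assms(1,2)] rook_laplacian_add algebra_simps)
  then show ?case by blast
qed

text \<open>\<open>equivalent\<close> allows either direction; a firing sequence from
  \<open>F\<close> to \<open>D\<close> is reversed by negating its script.\<close>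

lemma equivalent_complete_product:
  assumes "complete_digraph n K" "complete_digraph m L" "equivalent (K \<box> L) D F"
  shows "\<exists>f. F = (\<lambda>w. D w - rook_laplacian (verts K) (verts L) f w)"
  using assms(3) unfolding equivalent_def
proof
  assume "(firing_step (K \<box> L))\<^sup>*\<^sup>* F D"
  then obtain f where "D = (\<lambda>w. F w - rook_laplacian (verts K) (verts L) f w)"
    using firing_steps_complete_product[OF assms(1,2)] by blast
  then have "F = (\<lambda>w. D w - rook_laplacian (verts K) (verts L) (\<lambda>u. - f u) w)"
    by (simp add: rook_laplacian_uminus)
  then show ?thesis by blast
qed (rule firing_steps_complete_product[OF assms(1,2)])

text \<open>The vertices of \<open>S\<close> are fired once each, one after another; intermediate
  divisors may become negative, which \<open>firing_step\<close> permits.\<close>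

lemma fire_set_complete_product:
  assumes "complete_digraph n K" "complete_digraph m L" "finite S" "S \<subseteq> verts (K \<box> L)"
  shows "(firing_step (K \<box> L))\<^sup>*\<^sup>* D
    (\<lambda>w. D w - rook_laplacian (verts K) (verts L) (\<lambda>u. of_bool (u \<in> S)) w)"
  using assms(3,4)
proof (induction rule: finite_induct)
  case empty
  have "(\<lambda>w. D w - rook_laplacian (verts K) (verts L) (\<lambda>u. of_bool (u \<in> {})) w) = D"
    by (auto simp: rook_laplacian_def)
  then show ?case by (simp only: rtranclp.rtrancl_refl)
next
  case (insert v S)
  let ?L = "rook_laplacian (verts K) (verts L)"
  have "(\<lambda>u. of_bool (u \<in> insert v S) :: int) = (\<lambda>u. of_bool (u \<in> S) + of_bool (u = v))"
    using insert.hyps by auto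
  then have "(\<lambda>w. D w - ?L (\<lambda>u. of_bool (u \<in> insert v S)) w)
      = fire (K \<box> L) v (\<lambda>w. D w - ?L (\<lambda>u. of_bool (u \<in> S)) w)"
    using insert.prems
    by (simp add: fire_complete_product[OF assms(1,2)] rook_laplacian_add algebra_simps)
  then have "firing_step (K \<box> L) (\<lambda>w. D w - ?L (\<lambda>u. of_bool (u \<in> S)) w)
      (\<lambda>w. D w - ?L (\<lambda>u. of_bool (u \<in> insert v S)) w)"
    using insert.prems unfolding firing_step_def by blast
  with insert show ?case by (meson insert_subset rtranclp.rtrancl_into_rtrancl)
qed

section \<open>Rank at least 1 and the two bounds on gonality\<close>

text \<open>Reduces testing rank at least 1 to removing one chip from one vertex.\<close>

lemma effective_deg_1:
  assumes "finite (verts G)" "effective G E" "deg G E = 1"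
  obtains v where "v \<in> verts G" "E = (\<lambda>w. of_bool (w = v))"
proof -
  have nonneg: "0 \<le> E w" and off: "w \<notin> verts G \<Longrightarrow> E w = 0" for w
    using assms(2) by (auto simp: effective_def divisor_def)
  obtain v where v: "v \<in> verts G" "E v \<noteq> 0"
    using assms(3) unfolding deg_def by (metis sum.neutral zero_neq_one)
  have "sum E (verts G) = E v + sum E (verts G - {v})"
    using assms(1) v(1) by (rule sum.remove)
  moreover have "0 \<le> sum E (verts G - {v})" using nonneg by (simp add: sum_nonneg)
  ultimately have "E v = 1" "sum E (verts G - {v}) = 0"
    using assms(3) nonneg[of v] v(2) by (auto simp: deg_def)
  then have "E w = 0" if "w \<in> verts G - {v}" for w
    using that assms(1) nonneg by (simp add: sum_nonneg_eq_0_iff)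
  then have "E = (\<lambda>w. of_bool (w = v))"
    using off \<open>E v = 1\<close> by fastforce
  with v(1) show thesis by (rule that)
qed

lemma rank_at_least_1_complete_product_lower:
  assumes K: "complete_digraph n K" and L: "complete_digraph m L" and "n \<le> m"
    and rank: "rank_at_least (K \<box> L) D 1"
  shows "(int n - 1) * int m \<le> deg (K \<box> L) D"
proof -
  interpret K: graph K using K by (simp add: complete_digraph_def)
  interpret L: graph L using L by (simp add: complete_digraph_def)
  have cards: "card (verts K) = n" "card (verts L) = m"
    using K L by (simp_all add: complete_digraph_def)
  let ?L = "rook_laplacian (verts K) (verts L)"
  have "(int (card (verts K)) - 1) * int (card (verts L)) \<le> (\<Sum>x\<in>verts K. \<Sum>y\<in>verts L. D (x, y))"
  proof (rule rook_degree_lower_bound)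
    fix v assume v: "v \<in> verts K \<times> verts L"
    let ?E = "\<lambda>w. of_bool (w = v) :: int"
    have "effective (K \<box> L) ?E" "deg (K \<box> L) ?E = 1"
      using v by (auto simp: effective_def divisor_def deg_def)
    then obtain F where F: "effective (K \<box> L) F" "equivalent (K \<box> L) (\<lambda>w. D w - ?E w) F"
      using rank by (auto simp: rank_at_least_def)
    then obtain f where f: "F = (\<lambda>w. (D w - ?E w) - ?L f w)"
      using equivalent_complete_product[OF K L] by blast
    have "0 \<le> D w - ?L f w - ?E w" if "w \<in> verts K \<times> verts L" for w
      using F(1) that f by (force simp: effective_def)
    \<comment> \<open>Putting the removed chip back turns effectiveness of \<open>F\<close> into the
      two conditions of \<open>reach\<close>.\<close>
    then have le: "?E w \<le> D w - ?L f w" if "w \<in> verts K \<times> verts L" for w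
      using that by force
    have "0 \<le> D w - ?L f w" if "w \<in> verts K \<times> verts L" for w
      using le[OF that] by (cases "w = v") auto
    moreover have "1 \<le> D v - ?L f v"
      using le[OF v] by simp
    ultimately show "\<exists>f. (\<forall>w\<in>verts K \<times> verts L. 0 \<le> D w - ?L f w) \<and> 1 \<le> D v - ?L f v"
      by blast
  qed (use cards \<open>n \<le> m\<close> in auto)
  then show ?thesis
    by (simp add: cards deg_def sum.cartesian_product)
qed

lemma rank_at_least_1_complete_product_upper:
  fixes K :: "('a, 'b) pre_digraph" and L :: "('c, 'd) pre_digraph"
  assumes K: "complete_digraph n K" and L: "complete_digraph m L" and "2 \<le> n"
  shows "\<exists>D. divisor (K \<box> L) D \<and> rank_at_least (K \<box> L) D 1 \<and> deg (K \<box> L) D = (int n - 1) * int m"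
proof -
  interpret K: graph K using K by (simp add: complete_digraph_def)
  interpret L: graph L using L by (simp add: complete_digraph_def)
  have cards: "card (verts K) = n" "card (verts L) = m"
    using K L by (simp_all add: complete_digraph_def)
  let ?L = "rook_laplacian (verts K) (verts L)"
  obtain x\<^sub>0 where x\<^sub>0: "x\<^sub>0 \<in> verts K"
    using \<open>2 \<le> n\<close> cards by fastforce
  define S where "S = (verts K - {x\<^sub>0}) \<times> verts L"
  define D :: "'a \<times> 'c \<Rightarrow> int" where "D = (\<lambda>w. of_bool (w \<in> S))"
  have "S \<subseteq> verts (K \<box> L)" "finite S" by (auto simp: S_def)
  have "divisor (K \<box> L) D"
    by (auto simp: D_def S_def divisor_def)
  moreover have "deg (K \<box> L) D = (int n - 1) * int m"
  proof -
    have "deg (K \<box> L) D = int (card S)"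
      using \<open>S \<subseteq> verts (K \<box> L)\<close>
      by (simp add: deg_def D_def of_bool_def sum.If_cases Int_absorb1 flip: Int_def)
    also have "card S = (n - 1) * m"
      using x\<^sub>0 cards by (simp add: S_def card_cartesian_product)
    finally show ?thesis using \<open>2 \<le> n\<close> by (simp add: of_nat_diff)
  qed
  moreover have "rank_at_least (K \<box> L) D 1"
    unfolding rank_at_least_def
  proof (intro allI impI, elim conjE)
    fix E assume "effective (K \<box> L) E" "deg (K \<box> L) E = int 1"
    then obtain v where v: "v \<in> verts (K \<box> L)" and E: "E = (\<lambda>w. of_bool (w = v))"
      using effective_deg_1[of "K \<box> L" E] by auto
    show "\<exists>F. effective (K \<box> L) F \<and> equivalent (K \<box> L) (\<lambda>w. D w - E w) F"
    proof (cases "v \<in> S")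
      case True
      then have "effective (K \<box> L) (\<lambda>w. D w - E w)"
        using v by (auto simp: effective_def divisor_def D_def E S_def)
      then show ?thesis unfolding equivalent_def by blast
    next
      case False
      let ?F = "\<lambda>w. (D w - E w) - ?L (\<lambda>u. of_bool (u \<in> S)) w"
      have "fst v = x\<^sub>0" using v False by (auto simp: S_def)
      \<comment> \<open>Each vertex of \<open>S\<close> has one neighbour outside \<open>S\<close>,
        and each vertex over \<open>x\<^sub>0\<close> has \<open>n - 1\<close> neighbours in
        \<open>S\<close>. The latter thus receives \<open>n - 1 \<ge> 1\<close> chips, enough to pay
        for \<open>E\<close>.\<close>
      have "?L (\<lambda>u. of_bool (u \<in> S)) (x, y) = (if x = x\<^sub>0 then 1 - int n else 1)"
        if xy: "x \<in> verts K" "y \<in> verts L" for x y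
      proof -
        have "{x' \<in> verts K. (x', y) \<notin> S} = {x\<^sub>0}" "{x' \<in> verts K. (x', y) \<in> S} = verts K - {x\<^sub>0}"
          "{y' \<in> verts L. (x, y') \<notin> S} = (if x = x\<^sub>0 then verts L else {})"
          "{y' \<in> verts L. (x, y') \<in> S} = (if x = x\<^sub>0 then {} else verts L)"
          using xy x\<^sub>0 by (auto simp: S_def)
        then show ?thesis
          using xy x\<^sub>0 cards \<open>2 \<le> n\<close>
          by (subst rook_laplacian_indicator) (auto simp: S_def of_nat_diff)
      qed
      then have "effective (K \<box> L) ?F"
        using v \<open>fst v = x\<^sub>0\<close> \<open>2 \<le> n\<close>
        by (auto simp: effective_def divisor_def D_def E S_def rook_laplacian_def)
      moreover have "equivalent (K \<box> L) (\<lambda>w. D w - E w) ?F"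
        unfolding equivalent_def
        using fire_set_complete_product[OF K L \<open>finite S\<close> \<open>S \<subseteq> verts (K \<box> L)\<close>] by blast
      ultimately show ?thesis by blast
    qed
  qed
  ultimately show ?thesis by blast
qed

theorem theorem1p1:
  fixes K :: "('a, 'b) pre_digraph" and L :: "('c, 'd) pre_digraph" and n m :: nat
  assumes "complete_digraph n K" and "complete_digraph m L"
    and "2 \<le> n" and "n \<le> m"
  shows "gonality (K \<box> L) = (int n - 1) * int m"
  unfolding gonality_def
  using rank_at_least_1_complete_product_upper[OF assms(1-3)]
    rank_at_least_1_complete_product_lower[OF assms(1,2,4)]
  by (intro Least_equality) auto

end
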